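(* Let $\mathcal{A}$ be a finite alphabet with $\mathrm{Card}(\mathcal{A})=q\ge 2$, and let $k\ge 1$ and $N$ be integers with $q^k+k\le N\le q^{k+1}+k$. Then $K(N)=N-k$, where $K(N)$ denotes the global maximal complexity in $\mathcal{A}^N$.
   Context: $\mathcal{A}^n$ denotes the set of words of length $n$ over $\mathcal{A}$, i.e. finite sequences $w=w_1w_2\ldots w_n$ of letters of $\mathcal{A}$. A word $u$ is a factor (or subword) of $w$ if there exist (possibly empty) words $x,y$ over $\mathcal{A}$ with $w=xuy$ (so factors are contiguous). $F_n(w)$ is the set of all factors of $w$ of length $n$. The subword complexity of $w$ is $f_w(n)=\mathrm{Card}(F_n(w))$ for $1\le n\le |w|$ (and $f_w(n)=0$ for $n>|w|$). The maximal complexity of $w$ is $C(w)=\max\{f_w(n) : n\ge 1\}$. The global maximal complexity in $\mathcal{A}^N$ is $K(N)=\max\{C(w) : w\in\mathcal{A}^N\}$. *)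

theory Defs
  imports Main "HOL-Library.Sublist"
begin

text \<open>
  Words are lists; \<^const>\<open>sublist\<close> is the contiguous factor relation
  (as opposed to \<^const>\<open>subseq\<close>).
\<close>

definition words :: "'a set \<Rightarrow> nat \<Rightarrow> 'a list set" where
  "words A N = {w \<in> lists A. length w = N}"

definition factors :: "nat \<Rightarrow> 'a list \<Rightarrow> 'a list set" where
  "factors n w = {u. sublist u w \<and> length u = n}"

definition subword_complexity :: "'a list \<Rightarrow> nat \<Rightarrow> nat" where
  "subword_complexity w n = card (factors n w)"

definition maximal_complexity :: "'a list \<Rightarrow> nat" where
  "maximal_complexity w = Max {subword_complexity w n | n. n \<ge> 1}"

definition global_maximal_complexity :: "'a set \<Rightarrow> nat \<Rightarrow> nat" where
  "global_maximal_complexity A N = Max {maximal_complexity w | w. w \<in> words A N}"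

text \<open>
  \<^const>\<open>Max\<close> and \<^const>\<open>card\<close> are only meaningful on finite sets (and \<^const>\<open>Max\<close>
  on nonempty ones). The following facts show that this is the case above, and that
  the subword complexity vanishes beyond the length of the word.
\<close>

lemma finite_factors: "finite (factors n w)"
  by (rule finite_subset[of _ "set (sublists w)"]) (auto simp: factors_def)

lemma subword_complexity_eq_0: "length w < n \<Longrightarrow> subword_complexity w n = 0"
  using sublist_length_le[of _ w]
  by (fastforce simp: subword_complexity_def factors_def card_eq_0_iff)

lemma finite_subword_complexities: "finite {subword_complexity w n | n. n \<ge> 1}"
proof (rule finite_subset)
  show "{subword_complexity w n | n. n \<ge> 1} \<subseteq> insert 0 (subword_complexity w ` {..length w})"
  proof
    fix m
    assume "m \<in> {subword_complexity w n | n. n \<ge> 1}"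
    then obtain n where "m = subword_complexity w n" by blast
    then show "m \<in> insert 0 (subword_complexity w ` {..length w})"
      using subword_complexity_eq_0[of w n] by (cases "n \<le> length w") auto
  qed
qed simp

lemma subword_complexities_nonempty: "{subword_complexity w n | n. n \<ge> 1} \<noteq> {}"
  by blast

lemma finite_words: "finite A \<Longrightarrow> finite (words A N)"
  using finite_lists_length_eq[of A N] by (simp add: words_def lists_eq_set)

lemma finite_maximal_complexities:
  "finite A \<Longrightarrow> finite {maximal_complexity w | w. w \<in> words A N}"
  by (simp add: finite_words)

lemma maximal_complexities_nonempty:
  assumes "A \<noteq> {}"
  shows "{maximal_complexity w | w. w \<in> words A N} \<noteq> {}"
proof -
  from assms obtain a where "a \<in> A" by blast
  then have "replicate N a \<in> words A N" by (auto simp: words_def)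
  then show ?thesis by blast
qed

end

theory Submission
  imports Defs
begin

text \<open>
  At most \<open>q ^ n\<close> factors of length \<open>n\<close> exist, and at most \<open>N - n + 1\<close> of them fit into a word of
  length \<open>N\<close>; the first bound gives \<open>\<le> N - k\<close> for \<open>n \<le> k\<close>, the second one for \<open>n > k\<close>. Equality
  is attained at \<open>n = k + 1\<close> by a prefix of a linear de Bruijn word of order \<open>k + 1\<close>. Such
  a word is a longest one without repeated factors of length \<open>k + 1\<close>: it cannot be extended, so
  counting the occurrences of its last \<open>k\<close> letters shows that it closes up to a cycle; no rotation
  of the cycle can be extended either, so its set of factors is closed under dropping the first
  letter and appending an arbitrary one, and hence contains every word.
\<close>

text \<open>An infinite sequence \<open>f\<close> stands for a word, so that appending a letter is a
  function update and closing up to a cycle is reduction of the index.\<close>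

definition window :: "nat \<Rightarrow> (nat \<Rightarrow> 'a) \<Rightarrow> nat \<Rightarrow> 'a list" where
  "window n f i = map f [i..<i + n]"

lemma length_window [simp]: "length (window n f i) = n"
  by (simp add: window_def)

lemma window_Suc_snoc: "window (Suc n) f i = window n f i @ [f (i + n)]"
  by (simp add: window_def)

lemma window_Suc_Cons: "window (Suc n) f i = f i # window n f (Suc i)"
  by (simp add: window_def upt_conv_Cons del: upt_Suc)

lemma window_cong: "(\<And>j. j < n \<Longrightarrow> f (i + j) = g (i' + j)) \<Longrightarrow> window n f i = window n g i'"
  by (simp add: window_def list_eq_iff_nth_eq)

lemma window_nth: "window n f i = window n g i' \<Longrightarrow> j < n \<Longrightarrow> f (i + j) = g (i' + j)"
  by (simp add: window_def list_eq_iff_nth_eq)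

lemma set_window_subset: "range f \<subseteq> A \<Longrightarrow> set (window n f i) \<subseteq> A"
  by (auto simp: window_def)

text \<open>A walk along \<open>M\<close> distinct edges of the de Bruijn graph: vertices are
  windows of length \<open>k\<close>, edges those of length \<open>Suc k\<close>. Only the first
  \<open>M + k\<close> values of \<open>f\<close> enter the injectivity condition.\<close>

definition trail :: "'a set \<Rightarrow> nat \<Rightarrow> (nat \<Rightarrow> 'a) \<Rightarrow> nat \<Rightarrow> bool" where
  "trail A k f M \<longleftrightarrow> range f \<subseteq> A \<and> inj_on (window (Suc k) f) {..<M}"

lemma trail_le:
  assumes "finite A" "trail A k f M"
  shows "M \<le> card A ^ Suc k"
proof -
  have "window (Suc k) f ` {..<M} \<subseteq> {xs. set xs \<subseteq> A \<and> length xs = Suc k}"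
    using assms(2) set_window_subset[of f A] by (auto simp: trail_def)
  from card_mono[OF finite_lists_length_eq[OF assms(1)] this]
  have "card (window (Suc k) f ` {..<M}) \<le> card A ^ Suc k"
    using card_lists_length_eq[OF assms(1), of "Suc k"] by simp
  moreover have "card (window (Suc k) f ` {..<M}) = M"
    using assms(2) by (simp add: trail_def card_image)
  ultimately show ?thesis by simp
qed

text \<open>Windows of length \<open>Suc k\<close> starting before \<open>M\<close> end before
  position \<open>M + k\<close>, so this value may be replaced by \<open>x\<close> freely.\<close>

lemma trail_extend:
  assumes "trail A k f M" "x \<in> A" "window k f M @ [x] \<notin> window (Suc k) f ` {..<M}"
  shows "\<exists>g. trail A k g (Suc M)"
proof -
  define g where "g = f(M + k := x)"
  have same: "window (Suc k) g i = window (Suc k) f i" if "i < M" for i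
    using that by (intro window_cong) (simp add: g_def)
  have "window k g M = window k f M"
    by (intro window_cong) (simp add: g_def)
  then have "window (Suc k) g M = window k f M @ [x]"
    by (simp add: window_Suc_snoc g_def)
  moreover have "inj_on (window (Suc k) g) {..<M}"
    using assms(1) same by (simp add: trail_def inj_on_def)
  moreover have "window (Suc k) g ` {..<M} = window (Suc k) f ` {..<M}"
    using same by (intro image_cong) auto
  ultimately have "inj_on (window (Suc k) g) {..<Suc M}"
    using assms(3) by (simp add: lessThan_Suc)
  moreover have "range g \<subseteq> A"
    using assms(1,2) by (auto simp: trail_def g_def)
  ultimately show ?thesis by (auto simp: trail_def)
qed

text \<open>Degree count: a stuck trail has used all \<open>card A\<close> edges leaving its end
  vertex, so it has been there \<open>card A\<close> times before. If it did not start there, all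
  these visits and the final one need distinct entering edges, one too many.\<close>

lemma trail_closed:
  assumes "finite A" "trail A k f M"
    and full: "\<And>x. x \<in> A \<Longrightarrow> window k f M @ [x] \<in> window (Suc k) f ` {..<M}"
  shows "window k f 0 = window k f M"
proof (rule ccontr)
  assume open_trail: "window k f 0 \<noteq> window k f M"
  define I where "I = {i. i < M \<and> window k f i = window k f M}"
  have fin: "finite I" by (simp add: I_def)
  have "A \<subseteq> (\<lambda>i. f (i + k)) ` I"
  proof
    fix x assume "x \<in> A"
    from full[OF this] obtain i where "i < M" "window k f M @ [x] = window (Suc k) f i"
      by blast
    then show "x \<in> (\<lambda>i. f (i + k)) ` I"
      by (auto simp: window_Suc_snoc I_def)
  qed
  then have "card A \<le> card I"
    using surj_card_le[OF fin] by blast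
  then have "card A < card (insert M I)"
    using fin by (simp add: I_def)
  moreover have pos: "i > 0" if "i \<in> insert M I" for i
    using that open_trail by (cases i) (auto simp: I_def)
  \<comment> \<open>Edges entering the same vertex differ only in their first letter
    \<open>f (i - 1)\<close>; \<open>pos\<close> rules out truncation in
    \<open>i - 1\<close>.\<close>
  have "inj_on (\<lambda>i. f (i - 1)) (insert M I)"
  proof (rule inj_onI)
    fix i j assume ij: "i \<in> insert M I" "j \<in> insert M I" "f (i - 1) = f (j - 1)"
    obtain i' j' where eq: "i = Suc i'" "j = Suc j'"
      using pos[OF ij(1)] pos[OF ij(2)] by (auto simp: gr0_conv_Suc)
    have "window (Suc k) f i' = window (Suc k) f j'"
      using ij unfolding window_Suc_Cons by (auto simp: eq I_def)
    moreover have "i' < M" "j' < M"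
      using ij by (auto simp: eq I_def)
    ultimately show "i = j"
      using assms(2) by (auto simp: trail_def eq inj_on_def)
  qed
  then have "card (insert M I) \<le> card A"
    using assms(1,2) by (intro card_inj_on_le) (auto simp: trail_def)
  ultimately show False by simp
qed

lemma de_Bruijn_trail_exists:
  assumes "finite A" "A \<noteq> {}"
  obtains f where "trail A k f (card A ^ Suc k)"
proof -
  let ?P = "\<lambda>M. \<exists>f. trail A k f M"
  from assms(2) obtain a where "a \<in> A" by blast
  then have "?P 0" by (intro exI[of _ "\<lambda>_. a"]) (auto simp: trail_def)
  moreover have bound: "M \<le> card A ^ Suc k" if "?P M" for M
    using that trail_le[OF assms(1)] by blast
  ultimately have "?P (GREATEST M. ?P M)"
    by (rule GreatestI_nat)
  moreover define M where "M = (GREATEST M. ?P M)"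
  ultimately obtain f where f: "trail A k f M" by blast
  have maximal: "\<not> trail A k g (Suc M)" for g
  proof
    assume "trail A k g (Suc M)"
    then have "Suc M \<le> M"
      unfolding M_def using bound by (intro Greatest_le_nat) blast+
    then show False by simp
  qed
  \<comment> \<open>Stated for every trail \<open>h\<close> of the maximal length \<open>M\<close>,
    since it is applied to the rotations as well as to \<open>f\<close>.\<close>
  have full: "window k h M @ [x] \<in> window (Suc k) h ` {..<M}" if "trail A k h M" "x \<in> A" for h x
    using trail_extend[OF that] maximal by blast
  have closed: "window k f 0 = window k f M"
    using trail_closed[OF assms(1) f] full[OF f] by blast
  have M: "M > 0"
    using full[OF f \<open>a \<in> A\<close>] by auto
  define g where "g i = f (i mod M)" for i
  \<comment> \<open>Induction is needed because \<open>k\<close> might exceed \<open>M\<close> at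
    this stage, so that subtracting \<open>M\<close> once need not land below
    \<open>M\<close>.\<close>
  have g_f: "g i = f i" if "i < M + k" for i
    using that
  proof (induction i rule: less_induct)
    case (less i)
    show ?case
    proof (cases "i < M")
      case False
      then have "g i = g (i - M)" by (simp add: g_def le_mod_geq)
      also have "\<dots> = f (i - M)" using less False M by simp
      also have "\<dots> = f i" using window_nth[OF closed, of "i - M"] less.prems False by simp
      finally show ?thesis .
    qed (simp add: g_def)
  qed
  have g_inj: "inj_on (window (Suc k) g) {..<M}"
  proof -
    have "window (Suc k) g i = window (Suc k) f i" if "i < M" for i
      using that by (intro window_cong g_f) simp
    then show ?thesis using f by (simp add: trail_def inj_on_def)
  qed
  have g_mod: "window n g i = window n g (i mod M)" for n i
    by (intro window_cong) (simp add: g_def mod_simps)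
  have shift: "trail A k (\<lambda>i. g (s + i)) M" for s
  proof -
    have eq: "window (Suc k) (\<lambda>i. g (s + i)) i = window (Suc k) g ((s + i) mod M)" for i
      by (subst g_mod[symmetric]) (intro window_cong, simp add: add.assoc)
    have "inj_on (window (Suc k) (\<lambda>i. g (s + i))) {..<M}"
    proof (rule inj_onI)
      fix i j assume ij: "i \<in> {..<M}" "j \<in> {..<M}"
        "window (Suc k) (\<lambda>i. g (s + i)) i = window (Suc k) (\<lambda>i. g (s + i)) j"
      then have "(s + i) mod M = (s + j) mod M"
        using M by (intro inj_onD[OF g_inj]) (auto simp: eq)
      \<comment> \<open>Passing to integers allows \<open>s\<close> to be cancelled from the
        congruence.\<close>
      then have "int i mod int M = int j mod int M"
        by (metis add_diff_cancel_left' mod_diff_left_eq of_nat_add zmod_int)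
      then show "i = j" using ij(1,2) by (simp flip: zmod_int)
    qed
    then show ?thesis using f by (auto simp: trail_def g_def)
  qed
  \<comment> \<open>The rotation starting at \<open>s\<close> ends in the vertex
    \<open>window k g s\<close>, so its maximality puts every edge leaving this vertex on the
    cycle.\<close>
  have step: "\<exists>t. window (Suc k) g t = window k g s @ [x] \<and> t < M" if "x \<in> A" for s x
  proof -
    have "window k (\<lambda>i. g (s + i)) M = window k g s"
      by (intro window_cong) (simp add: g_def mod_simps add.assoc add.left_commute[of _ M])
    with full[OF shift that, of s] obtain i
      where "window k g s @ [x] = window (Suc k) (\<lambda>i. g (s + i)) i"
      by auto
    also have "\<dots> = window (Suc k) g (s + i)"
      by (intro window_cong) (simp add: add.assoc)
    also have "\<dots> = window (Suc k) g ((s + i) mod M)" by (rule g_mod)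
    finally show ?thesis using M by (intro exI[of _ "(s + i) mod M"]) simp
  qed
  \<comment> \<open>Following the letters of \<open>u\<close> from vertex 0 shifts them in from the
    right; once \<open>length u = k\<close>, the vertex reached is \<open>u\<close> itself.\<close>
  have reach: "\<exists>s. window k g s = drop (length u) (window k g 0 @ u)" if "set u \<subseteq> A" for u
    using that
  proof (induction u rule: rev_induct)
    case Nil
    show ?case by auto
  next
    case (snoc x u)
    then obtain s where s: "window k g s = drop (length u) (window k g 0 @ u)" by auto
    obtain t where "window (Suc k) g t = window k g s @ [x]"
      using step[of x s] snoc.prems by auto
    then have "window k g (Suc t) = tl (window k g s @ [x])"
      by (metis window_Suc_Cons list.sel(3))
    also have "window k g s @ [x] = drop (length u) (window k g 0 @ u @ [x])"
      by (simp add: s)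
    also have "tl \<dots> = drop (length (u @ [x])) (window k g 0 @ u @ [x])"
      by (simp only: tl_drop drop_Suc length_append_singleton)
    finally show ?case by blast
  qed
  have "{xs. set xs \<subseteq> A \<and> length xs = Suc k} \<subseteq> window (Suc k) g ` {..<M}"
  proof
    fix w assume "w \<in> {xs. set xs \<subseteq> A \<and> length xs = Suc k}"
    then obtain u x where w: "w = u @ [x]" "set u \<subseteq> A" "x \<in> A" "length u = k"
      by (auto simp: length_Suc_conv_rev)
    obtain s where "window k g s = u" using reach[OF w(2)] w(4) by auto
    then show "w \<in> window (Suc k) g ` {..<M}" using step[OF w(3), of s] w(1) by force
  qed
  from card_mono[OF _ this] have "card A ^ Suc k \<le> card (window (Suc k) g ` {..<M})"
    using card_lists_length_eq[OF assms(1), of "Suc k"] by simp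
  also have "\<dots> \<le> M" using card_image_le[of "{..<M}" "window (Suc k) g"] by simp
  finally have "M = card A ^ Suc k" using trail_le[OF assms(1) f] by simp
  with f that show ?thesis by blast
qed

lemma subword_complexity_le_power:
  assumes "finite A" "set w \<subseteq> A"
  shows "subword_complexity w n \<le> card A ^ n"
proof -
  have "factors n w \<subseteq> {xs. set xs \<subseteq> A \<and> length xs = n}"
    using assms(2) by (auto simp: factors_def dest: set_mono_sublist)
  from card_mono[OF finite_lists_length_eq[OF assms(1)] this] show ?thesis
    using card_lists_length_eq[OF assms(1), of n] by (simp add: subword_complexity_def)
qed

text \<open>A factor is determined by its starting position. Truncated subtraction makes the bound 0
  when \<open>n\<close> exceeds the length.\<close>

lemma subword_complexity_le_length: "subword_complexity w n \<le> Suc (length w) - n"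
proof -
  have "factors n w \<subseteq> (\<lambda>i. take n (drop i w)) ` {..<Suc (length w) - n}"
  proof
    fix u assume "u \<in> factors n w"
    then obtain x y where "w = x @ u @ y" "length u = n"
      by (auto simp: factors_def sublist_def)
    then show "u \<in> (\<lambda>i. take n (drop i w)) ` {..<Suc (length w) - n}"
      by (intro image_eqI[of _ _ "length x"]) auto
  qed
  from surj_card_le[OF _ this] show ?thesis by (simp add: subword_complexity_def)
qed

lemma trail_subword_complexity:
  assumes "trail A k f M" "N - k \<le> M"
  shows "N - k \<le> subword_complexity (map f [0..<N]) (Suc k)"
proof -
  have "window (Suc k) f ` {..<N - k} \<subseteq> factors (Suc k) (map f [0..<N])"
  proof clarify
    fix i assume "i < N - k"
    then have "[0..<N] = [0..<i] @ [i..<i + Suc k] @ [i + Suc k..<N]"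
      using upt_add_eq_append[of 0 i "N - i"] upt_add_eq_append[of i "i + Suc k" "N - i - Suc k"]
      by (simp del: upt_Suc)
    then have "map f [0..<N] = map f [0..<i] @ window (Suc k) f i @ map f [i + Suc k..<N]"
      unfolding window_def by (metis map_append)
    then show "window (Suc k) f i \<in> factors (Suc k) (map f [0..<N])"
      unfolding factors_def sublist_def mem_Collect_eq by (metis length_window)
  qed
  from card_mono[OF finite_factors this]
  have "card (window (Suc k) f ` {..<N - k}) \<le> subword_complexity (map f [0..<N]) (Suc k)"
    by (simp add: subword_complexity_def)
  moreover have "inj_on (window (Suc k) f) {..<N - k}"
    using assms by (auto simp: trail_def intro: inj_on_subset)
  ultimately show ?thesis by (simp add: card_image)
qed

theorem proposition1:
  fixes A :: "'a set" and q k N :: nat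
  assumes "finite A" and "card A = q" and "q \<ge> 2"
    and "k \<ge> 1"
    and "q ^ k + k \<le> N" and "N \<le> q ^ (k + 1) + k"
  shows "global_maximal_complexity A N = N - k"
proof -
  have upper: "maximal_complexity w \<le> N - k" if "w \<in> words A N" for w
  proof -
    have w: "set w \<subseteq> A" "length w = N" using that by (auto simp: words_def)
    have "subword_complexity w n \<le> N - k" for n
    proof (cases "n \<le> k")
      case True
      have "subword_complexity w n \<le> q ^ n"
        using subword_complexity_le_power[OF assms(1) w(1)] assms(2) by simp
      also have "\<dots> \<le> q ^ k" using True assms(3) by (intro power_increasing) auto
      finally show ?thesis using assms(5) by simp
    next
      case False
      then show ?thesis using subword_complexity_le_length[of w n] w(2) by simp
    qed
    then show ?thesis
      unfolding maximal_complexity_def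
      using finite_subword_complexities subword_complexities_nonempty by (subst Max_le_iff) auto
  qed
  have "A \<noteq> {}" using assms(2,3) by auto
  with assms(1) obtain f where f: "trail A k f (card A ^ Suc k)"
    by (rule de_Bruijn_trail_exists)
  define w where "w = map f [0..<N]"
  have w: "w \<in> words A N" using f by (force simp: w_def words_def trail_def)
  \<comment> \<open>The upper bound on \<open>N\<close> ensures that the \<open>N - k\<close>
    windows of the prefix all lie within the trail.\<close>
  have "N - k \<le> subword_complexity w (Suc k)"
    unfolding w_def using f assms(2,6) by (intro trail_subword_complexity) auto
  also have "\<dots> \<le> maximal_complexity w"
    unfolding maximal_complexity_def by (rule Max_ge[OF finite_subword_complexities]) force
  finally have "maximal_complexity w = N - k" using upper[OF w] by simp
  then show ?thesis
    unfolding global_maximal_complexity_def using upper w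
    by (intro Max_eqI finite_maximal_complexities[OF assms(1)]) force+
qed

end
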